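(* The hydrostatic reconstruction scheme for the multilayer shallow water equations with the numerical flux $$\mathbf f^{ES}_\epsilon=\mathbf f^{EC}_\epsilon-\tfrac12|\lambda_{\max}|[\![\mathbf u_\epsilon]\!],\qquad \mathbf f^{EC}_{m,\epsilon}=\begin{pmatrix}\{\!\{h_{m,\epsilon}v_m\}\!\}\\ \{\!\{h_{m,\epsilon}v_m\}\!\}\{\!\{v_m\}\!\}\end{pmatrix},$$ and the numerical nonconservative term $\tfrac12\boldsymbol\phi_\epsilon^-\circ[\![\mathbf r_\epsilon]\!]$ is entropy stable; that is, at every interface and for all states, $$[\![\mathbf w]\!]^T\mathbf f^{ES}_\epsilon-\{\!\{\mathbf w\circ\boldsymbol\phi_\epsilon\}\!\}^T[\![\mathbf r_\epsilon]\!]\le0 .$$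
   Context: Constants: $M\ge1$, $g>0$, densities $0<\rho_1<\dots<\rho_M$ (layers counted top to bottom), $\sigma_{km}=\rho_k/\rho_m$. Multilayer shallow water equations, $m=1,\dots,M$: $\partial_t h_m+\partial_x(h_mv_m)=0$, $\partial_t(h_mv_m)+\partial_x(h_mv_m^2)=-gh_m\partial_x\big(b+\sum_{k\ge m}h_k+\sum_{k<m}\sigma_{km}h_k\big)$. Layer components: $\mathbf u_m=(h_m,h_mv_m)^T$, $\mathbf f_m=(h_mv_m,h_mv_m^2)^T$, $\boldsymbol\phi_m=g(0,h_m)^T$, $\mathbf r_m=\big(0,\,b+\sum_{k\ge m}h_k+\sum_{k<m}\sigma_{km}h_k\big)^T$; unindexed symbols are stacked vectors, $\circ$ the Hadamard product. Entropy $S=\sum_m\rho_m\big(\frac12h_mv_m^2+\frac12gh_m^2+gh_mb+g\sum_{k<m}\sigma_{km}h_kh_m\big)$; entropy variables $\mathbf w=\partial_{\mathbf u}S$ with $\mathbf w_m=\big(\rho_mg(b+\sum_{k\ge m}h_k+\sum_{k<m}\sigma_{km}h_k)-\frac12\rho_mv_m^2,\ \rho_mv_m\big)^T$; entropy flux $f^S=\mathbf w^T\mathbf f$. Data: cells of size $\Delta x$ with constant values $b\in\mathbb R$, $h_m\ge0$, $v_m\in\mathbb R$. At an interface, $-$ and $+$ denote left and right cell values, $\{\!\{a\}\!\}=\frac12(a^++a^-)$, $[\![a]\!]=a^+-a^-$, $H_m=b+\sum_{k\ge m}h_k$. Hydrostatic reconstruction at each interface: $b_\epsilon^\pm=\min(H_1^\pm,\max(b^-,b^+))$,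 $H_{m,\epsilon}^\pm=\max(H_m^\pm,b_\epsilon^\pm)$, $h_{M,\epsilon}^\pm=H_{M,\epsilon}^\pm-b_\epsilon^\pm$, $h_{m,\epsilon}^\pm=H_{m,\epsilon}^\pm-H_{m+1,\epsilon}^\pm$ for $m<M$, $\mathbf u_{m,\epsilon}^\pm=(h_{m,\epsilon}^\pm,h_{m,\epsilon}^\pm v_m^\pm)^T$; $\boldsymbol\phi_\epsilon^\pm,\mathbf r_\epsilon^\pm$ are evaluated with $h_{m,\epsilon}^\pm,b_\epsilon^\pm$, while $\mathbf w^\pm$ is evaluated with the unreconstructed values. $\lambda_{\max}=\max\Big(\Big|\tfrac{\sum_mh_m^+v_m^+}{\sum_mh_m^+}\Big|,\Big|\tfrac{\sum_mh_m^-v_m^-}{\sum_mh_m^-}\Big|,\max_m|v_m^+|,\max_m|v_m^-|\Big)+\max\Big(\sqrt{g\sum_mh_m^+},\sqrt{g\sum_mh_m^-}\Big)$ (a quotient with zero denominator is omitted). Hydrostatic reconstruction scheme with numerical flux $\mathbf f^*_\epsilon$: $\Delta x\frac{d}{dt}\mathbf u_i=-(\mathbf f^*_{\epsilon,i+1/2}-\mathbf f^*_{\epsilon,i-1/2})-\tfrac12\boldsymbol\phi^-_{\epsilon,i+1/2}\circ[\![\mathbf r_\epsilon]\!]_{i+1/2}-\tfrac12\boldsymbol\phi^+_{\epsilon,i-1/2}\circ[\![\mathbf r_\epsilon]\!]_{i-1/2}$. The contribution of a single interface to the two adjacent cells changes their total entropy by $\Delta x\frac{d}{dt}(S^-+S^+)=[\![\mathbf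 w]\!]^T\mathbf f^*_\epsilon-[\![f^S]\!]-\{\!\{\mathbf w\circ\boldsymbol\phi_\epsilon\}\!\}^T[\![\mathbf r_\epsilon]\!]$; the scheme is entropy stable if this is $\le-[\![f^S]\!]$ at each interface, i.e. if $[\![\mathbf w]\!]^T\mathbf f^*_\epsilon-\{\!\{\mathbf w\circ\boldsymbol\phi_\epsilon\}\!\}^T[\![\mathbf r_\epsilon]\!]\le0$. *)

theory Defs
  imports "HOL-Analysis.Analysis"
begin

text \<open>
  Layers are numbered \<open>1..M\<close> from top to bottom; layer-indexed data are functions on \<open>nat\<close>
  of which only the values on \<open>{1..M}\<close> are ever used. A stacked vector of the
  two-component layer variables is a function \<open>nat \<Rightarrow> real \<times> real\<close>.
\<close>

record cell =
  bot :: real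
  hgt :: "nat \<Rightarrow> real"
  vel :: "nat \<Rightarrow> real"

type_synonym layered = "nat \<Rightarrow> real \<times> real"

definition avg :: "'a::real_vector \<Rightarrow> 'a \<Rightarrow> 'a" where
  "avg l r = (1/2) *\<^sub>R (r + l)"

definition jump :: "'a::real_vector \<Rightarrow> 'a \<Rightarrow> 'a" where
  "jump l r = r - l"

definition hadamard :: "real \<times> real \<Rightarrow> real \<times> real \<Rightarrow> real \<times> real" where
  "hadamard x y = (fst x * fst y, snd x * snd y)"

definition sdot :: "nat \<Rightarrow> layered \<Rightarrow> layered \<Rightarrow> real" where
  "sdot M x y = (\<Sum>m=1..M. x m \<bullet> y m)"


text \<open>Quantities of the multilayer shallow water equations.\<close>

definition surface :: "nat \<Rightarrow> cell \<Rightarrow> nat \<Rightarrow> real" where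
  "surface M c m = bot c + (\<Sum>k=m..M. hgt c k)"

definition head :: "nat \<Rightarrow> (nat \<Rightarrow> real) \<Rightarrow> cell \<Rightarrow> nat \<Rightarrow> real" where
  "head M rho c m = bot c + (\<Sum>k=m..M. hgt c k) + (\<Sum>k=1..<m. rho k / rho m * hgt c k)"

definition cons_vars :: "cell \<Rightarrow> layered" where
  "cons_vars c m = (hgt c m, hgt c m * vel c m)"

definition flux :: "cell \<Rightarrow> layered" where
  "flux c m = (hgt c m * vel c m, hgt c m * (vel c m)\<^sup>2)"

definition phi :: "real \<Rightarrow> cell \<Rightarrow> layered" where
  "phi g c m = g *\<^sub>R (0, hgt c m)"

definition rvec :: "nat \<Rightarrow> (nat \<Rightarrow> real) \<Rightarrow> cell \<Rightarrow> layered" where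
  "rvec M rho c m = (0, head M rho c m)"

definition entropy :: "nat \<Rightarrow> real \<Rightarrow> (nat \<Rightarrow> real) \<Rightarrow> cell \<Rightarrow> real" where
  "entropy M g rho c =
    (\<Sum>m=1..M. rho m * (1/2 * hgt c m * (vel c m)\<^sup>2 + 1/2 * g * (hgt c m)\<^sup>2 + g * hgt c m * bot c
                        + g * (\<Sum>k=1..<m. rho k / rho m * hgt c k * hgt c m)))"

definition entropy_vars :: "nat \<Rightarrow> real \<Rightarrow> (nat \<Rightarrow> real) \<Rightarrow> cell \<Rightarrow> layered" where
  "entropy_vars M g rho c m =
    (rho m * g * head M rho c m - 1/2 * rho m * (vel c m)\<^sup>2, rho m * vel c m)"

definition entropy_flux :: "nat \<Rightarrow> real \<Rightarrow> (nat \<Rightarrow> real) \<Rightarrow> cell \<Rightarrow> real" where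
  "entropy_flux M g rho c = sdot M (entropy_vars M g rho c) (flux c)"


text \<open>
  The entropy variables are the gradient of the entropy with respect to the conservative
  variables \<open>(h, q)\<close>, \<open>q = h v\<close>, wherever the layer is wet.
\<close>

definition cell_of_cons :: "real \<Rightarrow> (nat \<Rightarrow> real) \<Rightarrow> (nat \<Rightarrow> real) \<Rightarrow> cell" where
  "cell_of_cons b h q = \<lparr>bot = b, hgt = h, vel = (\<lambda>m. q m / h m)\<rparr>"

lemma entropy_gradient_momentum:
  assumes "j \<in> {1..M}" and "h j > 0"
  shows "((\<lambda>x. entropy M g rho (cell_of_cons b h (q(j := x))))
           has_real_derivative snd (entropy_vars M g rho (cell_of_cons b h q) j)) (at (q j))"
proof -
  define D where "D = (\<lambda>m. if m = j then rho j * (q j / h j) else 0)"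
  have "((\<lambda>x. entropy M g rho (cell_of_cons b h (q(j := x))))
           has_real_derivative (\<Sum>m=1..M. D m)) (at (q j))"
    unfolding entropy_def cell_of_cons_def cell.simps
  proof (rule DERIV_sum)
    fix m assume "m \<in> {1..M}"
    show "((\<lambda>x. rho m * (1/2 * h m * ((q(j := x)) m / h m)\<^sup>2 + 1/2 * g * (h m)\<^sup>2 + g * h m * b
              + g * (\<Sum>k=1..<m. rho k / rho m * h k * h m))) has_real_derivative D m) (at (q j))"
      using assms(2)
      by (cases "m = j") (auto simp: D_def power2_eq_square field_simps intro!: derivative_eq_intros)
  qed
  moreover have "(\<Sum>m=1..M. D m) = rho j * (q j / h j)"
    using assms(1) by (simp add: D_def)
  ultimately show ?thesis
    by (simp add: entropy_vars_def cell_of_cons_def)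
qed

lemma entropy_gradient_height:
  assumes "j \<in> {1..M}" and "h j > 0" and "\<And>m. m \<in> {1..M} \<Longrightarrow> rho m > 0"
  shows "((\<lambda>x. entropy M g rho (cell_of_cons b (h(j := x)) q))
           has_real_derivative fst (entropy_vars M g rho (cell_of_cons b h q) j)) (at (h j))"
proof -
  define e where "e = (\<lambda>m. if m = j then 1 else 0 :: real)"
  have e: "((\<lambda>x. (h(j := x)) m) has_real_derivative e m) (at (h j))" for m
    by (cases "m = j") (auto simp: e_def)
  have kin: "((\<lambda>x. 1/2 * (h(j := x)) m * (q m / (h(j := x)) m)\<^sup>2)
      has_real_derivative (- (1/2) * (q m / h m)\<^sup>2 * e m)) (at (h j))" for m
  proof (cases "m = j")
    case True
    have "((\<lambda>x. 1/2 * x * (q m / x)\<^sup>2) has_real_derivative (- (1/2) * (q m / h j)\<^sup>2)) (at (h j))"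
      by (rule derivative_eq_intros refl | use assms(2) in \<open>simp add: power2_eq_square field_simps\<close>)+
    then show ?thesis using True by (simp add: e_def)
  qed (auto simp: e_def)
  define D where "D = (\<lambda>m. rho m * (- (1/2) * (q m / h m)\<^sup>2 * e m + g * h m * e m + g * b * e m
     + g * (\<Sum>k=1..<m. rho k / rho m * (e k * h m + h k * e m))))"
  have "((\<lambda>x. entropy M g rho (cell_of_cons b (h(j := x)) q))
           has_real_derivative (\<Sum>m=1..M. D m)) (at (h j))"
    unfolding entropy_def cell_of_cons_def cell.simps
  proof (rule DERIV_sum)
    fix m assume "m \<in> {1..M}"
    have S: "((\<lambda>x. \<Sum>k=1..<m. rho k / rho m * (h(j := x)) k * (h(j := x)) m) has_real_derivative
       (\<Sum>k=1..<m. rho k / rho m * (e k * h m + h k * e m))) (at (h j))"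
    proof (rule DERIV_sum)
      fix k
      show "((\<lambda>x. rho k / rho m * (h(j := x)) k * (h(j := x)) m) has_real_derivative
              rho k / rho m * (e k * h m + h k * e m)) (at (h j))"
        using DERIV_cmult [OF DERIV_mult [OF e e], of "rho k / rho m" k m]
        by (simp add: ac_simps)
    qed
    have Q: "((\<lambda>x. 1/2 * g * ((h(j := x)) m)\<^sup>2) has_real_derivative g * h m * e m) (at (h j))"
      by (rule derivative_eq_intros e refl)+ simp
    have L: "((\<lambda>x. g * (h(j := x)) m * b) has_real_derivative g * b * e m) (at (h j))"
      by (rule derivative_eq_intros e refl)+ simp
    show "((\<lambda>x. rho m * (1/2 * (h(j := x)) m * (q m / (h(j := x)) m)\<^sup>2 + 1/2 * g * ((h(j := x)) m)\<^sup>2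
              + g * (h(j := x)) m * b
              + g * (\<Sum>k=1..<m. rho k / rho m * (h(j := x)) k * (h(j := x)) m)))
            has_real_derivative D m) (at (h j))"
      unfolding D_def
      by (rule DERIV_cmult DERIV_add kin Q L S)+
  qed
  moreover have "(\<Sum>m=1..M. D m) =
      rho j * g * head M rho (cell_of_cons b h q) j - 1/2 * rho j * (q j / h j)\<^sup>2"
  proof -
    have D: "D m = (if m = j then rho j * (- (1/2) * (q j / h j)\<^sup>2 + g * h j + g * b
              + g * (\<Sum>k=1..<j. rho k / rho j * h k)) else 0)
         + (if j < m then rho j * g * h m else 0)" if m: "m \<in> {1..M}" for m
    proof -
      have s: "(\<Sum>k=1..<m. rho k / rho m * (e k * h m + h k * e m)) =
          (\<Sum>k=1..<m. if k = j then rho j / rho m * h m else 0)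
          + e m * (\<Sum>k=1..<m. rho k / rho m * h k)"
        unfolding sum_distrib_left sum.distrib [symmetric]
        by (rule sum.cong) (auto simp: e_def algebra_simps)
      show ?thesis
        using assms(1) assms(3)[OF m] unfolding D_def s
        by (auto simp: e_def algebra_simps)
    qed
    have "(\<Sum>m=1..M. if j < m then rho j * g * h m else 0) = rho j * g * (\<Sum>m=Suc j..M. h m)"
      unfolding sum_distrib_left by (rule sum.mono_neutral_cong_right) auto
    moreover have "(\<Sum>m=j..M. h m) = h j + (\<Sum>m=Suc j..M. h m)"
      using assms(1) by (simp add: sum.atLeast_Suc_atMost)
    ultimately show ?thesis
      using assms(1)
      by (simp add: D sum.distrib head_def cell_of_cons_def algebra_simps)
  qed
  ultimately show ?thesis
    by (simp add: entropy_vars_def cell_of_cons_def)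
qed


text \<open>
  Hydrostatic reconstruction. The reconstruction of a cell at an interface depends on the
  neighbouring cell only through \<open>B\<close>, the larger of the two bottom values there.
\<close>

definition bot_rec :: "nat \<Rightarrow> real \<Rightarrow> cell \<Rightarrow> real" where
  "bot_rec M B c = min (surface M c 1) B"

definition surface_rec :: "nat \<Rightarrow> real \<Rightarrow> cell \<Rightarrow> nat \<Rightarrow> real" where
  "surface_rec M B c m = max (surface M c m) (bot_rec M B c)"

definition hgt_rec :: "nat \<Rightarrow> real \<Rightarrow> cell \<Rightarrow> nat \<Rightarrow> real" where
  "hgt_rec M B c m =
    (if m = M then surface_rec M B c M - bot_rec M B c
     else surface_rec M B c m - surface_rec M B c (m + 1))"

definition reconstruct :: "nat \<Rightarrow> real \<Rightarrow> cell \<Rightarrow> cell" where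
  "reconstruct M B c = \<lparr>bot = bot_rec M B c, hgt = hgt_rec M B c, vel = vel c\<rparr>"

definition rec_left :: "nat \<Rightarrow> cell \<Rightarrow> cell \<Rightarrow> cell" where
  "rec_left M cl cr = reconstruct M (max (bot cl) (bot cr)) cl"

definition rec_right :: "nat \<Rightarrow> cell \<Rightarrow> cell \<Rightarrow> cell" where
  "rec_right M cl cr = reconstruct M (max (bot cl) (bot cr)) cr"

definition jump_r :: "nat \<Rightarrow> (nat \<Rightarrow> real) \<Rightarrow> cell \<Rightarrow> cell \<Rightarrow> layered" where
  "jump_r M rho cl cr m =
    jump (rvec M rho (rec_left M cl cr) m) (rvec M rho (rec_right M cl cr) m)"

definition jump_w :: "nat \<Rightarrow> real \<Rightarrow> (nat \<Rightarrow> real) \<Rightarrow> cell \<Rightarrow> cell \<Rightarrow> layered" where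
  "jump_w M g rho cl cr m = jump (entropy_vars M g rho cl m) (entropy_vars M g rho cr m)"

definition avg_w_phi :: "nat \<Rightarrow> real \<Rightarrow> (nat \<Rightarrow> real) \<Rightarrow> cell \<Rightarrow> cell \<Rightarrow> layered" where
  "avg_w_phi M g rho cl cr m =
    avg (hadamard (entropy_vars M g rho cl m) (phi g (rec_left M cl cr) m))
        (hadamard (entropy_vars M g rho cr m) (phi g (rec_right M cl cr) m))"


text \<open>
  The scheme for a numerical flux \<open>F\<close>, written as the value of \<open>\<Delta>x du/dt\<close> in cell \<open>c\<close> with
  neighbours \<open>cl\<close> and \<open>cr\<close>.
\<close>

definition noncons_left :: "nat \<Rightarrow> real \<Rightarrow> (nat \<Rightarrow> real) \<Rightarrow> cell \<Rightarrow> cell \<Rightarrow> layered" where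
  "noncons_left M g rho cl cr m =
    (1/2) *\<^sub>R hadamard (phi g (rec_left M cl cr) m) (jump_r M rho cl cr m)"

definition noncons_right :: "nat \<Rightarrow> real \<Rightarrow> (nat \<Rightarrow> real) \<Rightarrow> cell \<Rightarrow> cell \<Rightarrow> layered" where
  "noncons_right M g rho cl cr m =
    (1/2) *\<^sub>R hadamard (phi g (rec_right M cl cr) m) (jump_r M rho cl cr m)"

definition scheme_rhs ::
  "nat \<Rightarrow> real \<Rightarrow> (nat \<Rightarrow> real) \<Rightarrow> (cell \<Rightarrow> cell \<Rightarrow> layered) \<Rightarrow> cell \<Rightarrow> cell \<Rightarrow> cell \<Rightarrow> layered" where
  "scheme_rhs M g rho F cl c cr m =
    - (F c cr m - F cl c m) - noncons_left M g rho c cr m - noncons_right M g rho cl c m"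

text \<open>
  Contributions of a single interface to its two adjacent cells: the physical flux of the
  cell is added on one side and cancels against the other interface of the same cell.
\<close>

definition contrib_left ::
  "nat \<Rightarrow> real \<Rightarrow> (nat \<Rightarrow> real) \<Rightarrow> (cell \<Rightarrow> cell \<Rightarrow> layered) \<Rightarrow> cell \<Rightarrow> cell \<Rightarrow> layered" where
  "contrib_left M g rho F cl cr m = flux cl m - F cl cr m - noncons_left M g rho cl cr m"

definition contrib_right ::
  "nat \<Rightarrow> real \<Rightarrow> (nat \<Rightarrow> real) \<Rightarrow> (cell \<Rightarrow> cell \<Rightarrow> layered) \<Rightarrow> cell \<Rightarrow> cell \<Rightarrow> layered" where
  "contrib_right M g rho F cl cr m = F cl cr m - flux cr m - noncons_right M g rho cl cr m"

lemma scheme_rhs_eq_contrib: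
  "scheme_rhs M g rho F cl c cr m =
     contrib_left M g rho F c cr m + contrib_right M g rho F cl c m"
  by (simp add: scheme_rhs_def contrib_left_def contrib_right_def)

text \<open>
  Rate of change of the total entropy \<open>\<Delta>x (S\<^sup>- + S\<^sup>+)\<close> of the two cells due to their common
  interface; by the chain rule \<open>dS/dt\<close> is the product of the entropy variables with \<open>du/dt\<close>.
\<close>

definition interface_entropy_rate ::
  "nat \<Rightarrow> real \<Rightarrow> (nat \<Rightarrow> real) \<Rightarrow> (cell \<Rightarrow> cell \<Rightarrow> layered) \<Rightarrow> cell \<Rightarrow> cell \<Rightarrow> real" where
  "interface_entropy_rate M g rho F cl cr =
     sdot M (entropy_vars M g rho cl) (contrib_left M g rho F cl cr)
   + sdot M (entropy_vars M g rho cr) (contrib_right M g rho F cl cr)"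

lemma interface_entropy_rate_eq:
  "interface_entropy_rate M g rho F cl cr =
     sdot M (jump_w M g rho cl cr) (F cl cr)
     - jump (entropy_flux M g rho cl) (entropy_flux M g rho cr)
     - sdot M (avg_w_phi M g rho cl cr) (jump_r M rho cl cr)"
  unfolding interface_entropy_rate_def entropy_flux_def sdot_def
    jump_def [of "\<Sum>m=1..M. entropy_vars M g rho cl m \<bullet> flux cl m"]
    sum.distrib [symmetric] sum_subtractf [symmetric]
proof (rule sum.cong [OF refl])
  fix m
  obtain w1 w2 where w: "entropy_vars M g rho cl m = (w1, w2)" by fastforce
  obtain z1 z2 where z: "entropy_vars M g rho cr m = (z1, z2)" by fastforce
  obtain f1 f2 where f: "F cl cr m = (f1, f2)" by fastforce
  obtain r1 r2 where r: "jump_r M rho cl cr m = (r1, r2)" by fastforce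
  show "entropy_vars M g rho cl m \<bullet> contrib_left M g rho F cl cr m
      + entropy_vars M g rho cr m \<bullet> contrib_right M g rho F cl cr m
      = jump_w M g rho cl cr m \<bullet> F cl cr m
        - (entropy_vars M g rho cr m \<bullet> flux cr m - entropy_vars M g rho cl m \<bullet> flux cl m)
        - avg_w_phi M g rho cl cr m \<bullet> jump_r M rho cl cr m"
    by (simp add: contrib_left_def contrib_right_def noncons_left_def noncons_right_def
        jump_w_def avg_w_phi_def jump_def avg_def hadamard_def phi_def flux_def w z f r)
       (simp add: field_simps)
qed

definition admissible :: "nat \<Rightarrow> cell \<Rightarrow> bool" where
  "admissible M c \<longleftrightarrow> (\<forall>m\<in>{1..M}. 0 \<le> hgt c m)"

definition entropy_stable ::
  "nat \<Rightarrow> real \<Rightarrow> (nat \<Rightarrow> real) \<Rightarrow> (cell \<Rightarrow> cell \<Rightarrow> layered) \<Rightarrow> bool" where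
  "entropy_stable M g rho F \<longleftrightarrow>
    (\<forall>cl cr. admissible M cl \<longrightarrow> admissible M cr \<longrightarrow>
       interface_entropy_rate M g rho F cl cr
         \<le> - jump (entropy_flux M g rho cl) (entropy_flux M g rho cr))"


definition mean_speed :: "nat \<Rightarrow> cell \<Rightarrow> real set" where
  "mean_speed M c =
    (if (\<Sum>m=1..M. hgt c m) = 0 then {}
     else {\<bar>(\<Sum>m=1..M. hgt c m * vel c m) / (\<Sum>m=1..M. hgt c m)\<bar>})"

definition lambda_max :: "nat \<Rightarrow> real \<Rightarrow> cell \<Rightarrow> cell \<Rightarrow> real" where
  "lambda_max M g cl cr =
    Max (mean_speed M cr \<union> mean_speed M cl
         \<union> (\<lambda>m. \<bar>vel cr m\<bar>) ` {1..M} \<union> (\<lambda>m. \<bar>vel cl m\<bar>) ` {1..M})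
    + max (sqrt (g * (\<Sum>m=1..M. hgt cr m))) (sqrt (g * (\<Sum>m=1..M. hgt cl m)))"

definition flux_EC :: "nat \<Rightarrow> cell \<Rightarrow> cell \<Rightarrow> layered" where
  "flux_EC M cl cr m =
    (let q = avg (hgt (rec_left M cl cr) m * vel cl m) (hgt (rec_right M cl cr) m * vel cr m)
     in (q, q * avg (vel cl m) (vel cr m)))"

definition flux_ES :: "nat \<Rightarrow> real \<Rightarrow> cell \<Rightarrow> cell \<Rightarrow> layered" where
  "flux_ES M g cl cr m =
    flux_EC M cl cr m
    - (1/2 * \<bar>lambda_max M g cl cr\<bar>)
        *\<^sub>R jump (cons_vars (rec_left M cl cr) m) (cons_vars (rec_right M cl cr) m)"

end

theory Submission
  imports Defs
begin

text \<open>
  Write \<open>P\<^sub>m\<close> for the head of layer \<open>m\<close>, \<open>H\<^sub>m\<close> for its surface, \<open>a = \<bar>\<lambda>\<^sub>m\<^sub>a\<^sub>x\<bar>\<close>, and mark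
  reconstructed quantities with a prime; brackets are jumps and double braces are averages over
  the interface. Layer by layer the kinetic terms of the conservative flux cancel, and the
  expression to be bounded is the sum over \<open>m\<close> of
  \<open>\<rho>\<^sub>m (g {{h'\<^sub>m v\<^sub>m}} [P\<^sub>m - P'\<^sub>m] - a/2 g [P\<^sub>m] [h'\<^sub>m] - a/2 {{h'\<^sub>m}} [v\<^sub>m]\<^sup>2)\<close>.

  The sign rests on three observations. Reconstruction never lowers a head, and it changes the
  head of a layer only if it leaves that layer empty (\<open>head_le_head_reconstruct\<close>,
  \<open>hgt_reconstruct_mult_head_diff\<close>). Since \<open>a\<close> dominates the velocities, the product in the
  first term is then at most \<open>a/2 g [P\<^sub>m - P'\<^sub>m] [h'\<^sub>m]\<close> (\<open>flux_correction_le\<close>); as the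
  contribution of \<open>[v\<^sub>m]\<^sup>2\<close> is nonpositive, the total is at most
  \<open>- a/2 g (\<Sum>m. \<rho>\<^sub>m [P'\<^sub>m] [h'\<^sub>m])\<close>. Finally this sum is nonnegative: in terms of surfaces
  \<open>\<rho>\<^sub>m P\<^sub>m = (\<Sum>k\<le>m. (\<rho>\<^sub>k - \<rho>\<^sub>k\<^sub>-\<^sub>1) H\<^sub>k)\<close> with \<open>\<rho>\<^sub>0 = 0\<close> (\<open>density_mult_head\<close>), whence
  summation by parts turns it into \<open>\<Sum>k. (\<rho>\<^sub>k - \<rho>\<^sub>k\<^sub>-\<^sub>1) [H'\<^sub>k] [H'\<^sub>k - b']\<close> with \<open>b'\<close> the
  bottom, and each product of jumps is nonnegative (\<open>jump_surface_mult_jump_depth_nonneg\<close>),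
  because where the reconstructed bottom jumps, the side with the lower bottom is completely dry.
\<close>

section \<open>Heads in terms of layer surfaces\<close>

text \<open>Density increment across the upper surface of layer \<open>k\<close>, with zero density above layer 1.\<close>

definition density_step :: "(nat \<Rightarrow> real) \<Rightarrow> nat \<Rightarrow> real" where
  "density_step rho k = rho k - (if k = 1 then 0 else rho (k - 1))"

lemma density_pos:
  fixes rho :: "nat \<Rightarrow> real"
  assumes "rho 1 > 0" "strict_mono_on {1..M} rho" "m \<in> {1..M}"
  shows "rho m > 0"
proof (cases "m = 1")
  case False
  then have "rho 1 < rho m"
    using assms(3) by (intro strict_mono_onD[OF assms(2)]) auto
  then show ?thesis using assms(1) by simp
qed (use assms in simp)

lemma density_step_nonneg:
  assumes "rho 1 > 0" "strict_mono_on {1..M} rho" "k \<in> {1..M}"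
  shows "density_step rho k \<ge> 0"
proof (cases "k = 1")
  case False
  then have "rho (k - 1) < rho k"
    using assms(3) by (intro strict_mono_onD[OF assms(2)]) auto
  then show ?thesis using False by (simp add: density_step_def)
qed (use assms in \<open>simp add: density_step_def\<close>)

text \<open>With the convention of the empty sum, the surface below the lowest layer is the bottom.\<close>

lemma surface_Suc_bottom: "surface M c (Suc M) = bot c"
  by (simp add: surface_def)

lemma surface_eq_hgt_plus: "m \<le> M \<Longrightarrow> surface M c m = hgt c m + surface M c (Suc m)"
  by (simp add: surface_def sum.atLeast_Suc_atMost)

lemma surface_antimono:
  assumes "admissible M c" "1 \<le> i" "i \<le> j"
  shows "surface M c j \<le> surface M c i"
  unfolding surface_def
  using assms by (intro add_left_mono sum_mono2) (auto simp: admissible_def)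

lemma density_mult_head:
  assumes rho: "rho 1 > 0" "strict_mono_on {1..M} rho" and m: "m \<in> {1..M}"
  shows "rho m * head M rho c m = (\<Sum>k=1..m. density_step rho k * surface M c k)"
proof -
  have "rho m * surface M c m + (\<Sum>k=1..<m. rho k * hgt c k)
      = (\<Sum>k=1..m. density_step rho k * surface M c k)"
    if "1 \<le> m" "m \<le> M" for m
    using that
  proof (induction m rule: dec_induct)
    case base
    then show ?case by (simp add: density_step_def)
  next
    case (step n)
    then show ?case
      using surface_eq_hgt_plus[of n M c] by (simp add: density_step_def algebra_simps)
  qed
  moreover have "rho m * head M rho c m
      = rho m * surface M c m + (\<Sum>k=1..<m. rho k * hgt c k)"
    using density_pos[OF rho m] by (simp add: head_def surface_def distrib_left sum_distrib_left)
  ultimately show ?thesis using m by simp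
qed

lemma sum_by_parts_partial_sums:
  fixes d X :: "nat \<Rightarrow> real"
  shows "(\<Sum>m=1..M. (\<Sum>k=1..m. d k * X k) * (X m - X (Suc m)))
    = (\<Sum>k=1..M. d k * X k * (X k - X (Suc M)))"
proof (induction M)
  case (Suc M)
  have "(\<Sum>k=1..M. d k * X k * (X k - X (Suc (Suc M))))
      = (\<Sum>k=1..M. d k * X k * (X k - X (Suc M)))
        + (\<Sum>k=1..M. d k * X k) * (X (Suc M) - X (Suc (Suc M)))"
    by (simp add: sum_distrib_right flip: sum.distrib) (simp add: algebra_simps)
  with Suc show ?case by (simp add: algebra_simps)
qed simp

section \<open>Hydrostatic reconstruction of a single cell\<close>

lemma vel_reconstruct: "vel (reconstruct M B c) = vel c"
  by (simp add: reconstruct_def)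

lemma bot_reconstruct: "bot (reconstruct M B c) = min (surface M c 1) B"
  by (simp add: reconstruct_def bot_rec_def)

text \<open>
  Reconstruction truncates every surface from below by the reconstructed bottom. The hypothesis
  \<open>bot c \<le> B\<close> makes this hold for the bottom itself, the surface with index \<open>Suc M\<close>.
\<close>

lemma surface_reconstruct:
  assumes "admissible M c" "bot c \<le> B" "1 \<le> k" "k \<le> Suc M"
  shows "surface M (reconstruct M B c) k = max (surface M c k) (bot (reconstruct M B c))"
  using assms(4,3)
proof (induction k rule: inc_induct)
  case base
  have "bot c \<le> surface M c 1"
    using surface_antimono[OF assms(1), of 1 "Suc M"] by (simp add: surface_Suc_bottom)
  then show ?case
    using assms(2) by (simp add: surface_Suc_bottom bot_reconstruct)
next
  case (step n)
  have IH: "surface M (reconstruct M B c) (Suc n)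
      = max (surface M c (Suc n)) (bot (reconstruct M B c))"
    using step by simp
  have "hgt (reconstruct M B c) n = max (surface M c n) (bot (reconstruct M B c))
      - surface M (reconstruct M B c) (Suc n)"
  proof (cases "n = M")
    case True
    then show ?thesis
      unfolding True surface_Suc_bottom
      by (simp add: reconstruct_def hgt_rec_def surface_rec_def)
  next
    case False
    then show ?thesis
      unfolding IH by (simp add: reconstruct_def hgt_rec_def surface_rec_def)
  qed
  then show ?case
    using step surface_eq_hgt_plus[of n M "reconstruct M B c"] by simp
qed

lemma admissible_reconstruct:
  assumes "admissible M c" "bot c \<le> B"
  shows "admissible M (reconstruct M B c)"
  unfolding admissible_def
proof
  fix m assume m: "m \<in> {1..M}"
  have "surface M c (Suc m) \<le> surface M c m"
    using m by (intro surface_antimono[OF assms(1)]) auto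
  then have "surface M (reconstruct M B c) (Suc m) \<le> surface M (reconstruct M B c) m"
    using m by (simp add: surface_reconstruct[OF assms])
  then show "0 \<le> hgt (reconstruct M B c) m"
    using m surface_eq_hgt_plus[of m M "reconstruct M B c"] by simp
qed

lemma head_le_head_reconstruct:
  assumes "admissible M c" "bot c \<le> B" "m \<in> {1..M}"
    and rho: "rho 1 > 0" "strict_mono_on {1..M} rho"
  shows "head M rho c m \<le> head M rho (reconstruct M B c) m"
proof -
  have "rho m * head M rho c m \<le> rho m * head M rho (reconstruct M B c) m"
    unfolding density_mult_head[OF rho assms(3)]
    using assms(3) density_step_nonneg[OF rho] surface_reconstruct[OF assms(1,2)]
    by (intro sum_mono mult_left_mono) auto
  then show ?thesis using density_pos[OF rho assms(3)] by simp
qed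

text \<open>
  If layer \<open>m\<close> stays wet, its surface lies above the reconstructed bottom, and so do all surfaces
  above it; hence none of the surfaces that enter the head of layer \<open>m\<close> is moved.
\<close>

lemma hgt_reconstruct_mult_head_diff:
  assumes "admissible M c" "bot c \<le> B" "m \<in> {1..M}"
    and rho: "rho 1 > 0" "strict_mono_on {1..M} rho"
  shows "hgt (reconstruct M B c) m
      * (head M rho c m - head M rho (reconstruct M B c) m) = 0"
proof (cases "bot (reconstruct M B c) \<le> surface M c m")
  case True
  have "surface M (reconstruct M B c) k = surface M c k" if "k \<in> {1..m}" for k
    using that assms(3) True surface_antimono[OF assms(1), of k m]
    by (subst surface_reconstruct[OF assms(1,2)]) auto
  then have "rho m * head M rho c m = rho m * head M rho (reconstruct M B c) m"
    unfolding density_mult_head[OF rho assms(3)]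
    by (intro sum.cong) auto
  then show ?thesis using density_pos[OF rho assms(3)] by simp
next
  case False
  then have "surface M c (Suc m) \<le> bot (reconstruct M B c)"
    using surface_antimono[OF assms(1), of m "Suc m"] assms(3) by simp
  then have "surface M (reconstruct M B c) m = surface M (reconstruct M B c) (Suc m)"
    using False assms(3) by (simp add: surface_reconstruct[OF assms(1,2)])
  then show ?thesis
    using assms(3) surface_eq_hgt_plus[of m M "reconstruct M B c"] by simp
qed

section \<open>Positivity of the reconstructed potential energy jump\<close>

text \<open>
  A side whose reconstructed bottom lies below \<open>B\<close> is dry: its depth above the bottom vanishes.
  If both sides have bottom \<open>B\<close>, the product is a square; if both are dry, its second factor
  vanishes; if only one side has bottom \<open>B\<close>, both bottom and depth are at least as large there
  as on the dry side, so the two factors have the same sign.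
\<close>

lemma jump_surface_mult_jump_depth_nonneg:
  assumes "admissible M cl" "bot cl \<le> B" "admissible M cr" "bot cr \<le> B" "k \<in> {1..M}"
  defines "l \<equiv> reconstruct M B cl" and "r \<equiv> reconstruct M B cr"
  shows "0 \<le> (surface M r k - surface M l k)
      * ((surface M r k - bot r) - (surface M l k - bot l))"
proof -
  have depth: "bot (reconstruct M B c) \<le> surface M (reconstruct M B c) k"
      "bot (reconstruct M B c) = B \<or>
        bot (reconstruct M B c) < B
        \<and> surface M (reconstruct M B c) k = bot (reconstruct M B c)"
      "bot (reconstruct M B c) \<le> B"
    if c: "admissible M c" "bot c \<le> B" for c
  proof -
    show "bot (reconstruct M B c) \<le> surface M (reconstruct M B c) k"
      using assms(5) by (simp add: surface_reconstruct[OF c])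
    have "surface M c k \<le> surface M c 1"
      using assms(5) by (intro surface_antimono[OF c(1)]) auto
    then show "bot (reconstruct M B c) = B \<or>
        bot (reconstruct M B c) < B
        \<and> surface M (reconstruct M B c) k = bot (reconstruct M B c)"
      using assms(5) by (auto simp: surface_reconstruct[OF c] bot_reconstruct)
    show "bot (reconstruct M B c) \<le> B"
      by (simp add: bot_reconstruct)
  qed
  note L = depth[OF assms(1,2), folded l_def] and R = depth[OF assms(3,4), folded r_def]
  consider "bot l = B" "bot r = B"
    | "surface M l k = bot l" "surface M r k = bot r"
    | "surface M l k = bot l" "bot l < B" "bot r = B"
    | "surface M r k = bot r" "bot r < B" "bot l = B"
    using L R by linarith
  then show ?thesis
  proof cases
    case 3
    then show ?thesis using R(1) by (intro mult_nonneg_nonneg) auto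
  next
    case 4
    then show ?thesis using L(1) by (intro mult_nonpos_nonpos) auto
  qed auto
qed

lemma sum_jump_head_mult_jump_hgt_nonneg:
  assumes "admissible M cl" "bot cl \<le> B" "admissible M cr" "bot cr \<le> B"
    and rho: "rho 1 > 0" "strict_mono_on {1..M} rho"
  defines "l \<equiv> reconstruct M B cl" and "r \<equiv> reconstruct M B cr"
  shows "0 \<le> (\<Sum>m=1..M. rho m * (head M rho r m - head M rho l m) * (hgt r m - hgt l m))"
proof -
  define X where "X = (\<lambda>k. surface M r k - surface M l k)"
  have "rho m * (head M rho r m - head M rho l m) * (hgt r m - hgt l m)
      = (\<Sum>k=1..m. density_step rho k * X k) * (X m - X (Suc m))"
    if m: "m \<in> {1..M}" for m
  proof -
    have "rho m * (head M rho r m - head M rho l m) = (\<Sum>k=1..m. density_step rho k * X k)"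
      unfolding right_diff_distrib density_mult_head[OF rho m] X_def
      by (simp add: right_diff_distrib sum_subtractf)
    moreover have "hgt r m - hgt l m = X m - X (Suc m)"
      using m surface_eq_hgt_plus[of m M r] surface_eq_hgt_plus[of m M l] by (simp add: X_def)
    ultimately show ?thesis by simp
  qed
  then have "(\<Sum>m=1..M. rho m * (head M rho r m - head M rho l m) * (hgt r m - hgt l m))
      = (\<Sum>k=1..M. density_step rho k * X k * (X k - X (Suc M)))"
    unfolding sum_by_parts_partial_sums[symmetric] by (rule sum.cong[OF refl])
  also have "\<dots> \<ge> 0"
  proof (rule sum_nonneg)
    fix k assume k: "k \<in> {1..M}"
    have "X k - X (Suc M) = (surface M r k - bot r) - (surface M l k - bot l)"
      by (simp add: X_def surface_Suc_bottom)
    moreover have "0 \<le> X k * ((surface M r k - bot r) - (surface M l k - bot l))"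
      using jump_surface_mult_jump_depth_nonneg[OF assms(1-4) k]
      unfolding X_def l_def r_def .
    ultimately have "0 \<le> X k * (X k - X (Suc M))"
      by (simp only:)
    then show "0 \<le> density_step rho k * X k * (X k - X (Suc M))"
      using density_step_nonneg[OF rho k] by (simp add: mult.assoc)
  qed
  finally show ?thesis .
qed

section \<open>Entropy production at an interface\<close>

lemma abs_vel_le_lambda_max:
  assumes "m \<in> {1..M}" "g > 0" "admissible M cl"
  shows "\<bar>vel cl m\<bar> \<le> lambda_max M g cl cr" "\<bar>vel cr m\<bar> \<le> lambda_max M g cl cr"
proof -
  let ?A = "mean_speed M cr \<union> mean_speed M cl
    \<union> (\<lambda>m. \<bar>vel cr m\<bar>) ` {1..M} \<union> (\<lambda>m. \<bar>vel cl m\<bar>) ` {1..M}"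
  have "finite ?A"
    by (simp add: mean_speed_def)
  then have "\<bar>vel cl m\<bar> \<le> Max ?A" "\<bar>vel cr m\<bar> \<le> Max ?A"
    using assms(1) by (auto intro!: Max_ge)
  moreover have "0 \<le> sqrt (g * (\<Sum>m=1..M. hgt cl m))"
    using assms by (auto simp: admissible_def intro!: mult_nonneg_nonneg sum_nonneg)
  ultimately show "\<bar>vel cl m\<bar> \<le> lambda_max M g cl cr" "\<bar>vel cr m\<bar> \<le> lambda_max M g cl cr"
    unfolding lambda_max_def by linarith+
qed

lemma layer_entropy_production_eq:
  fixes M :: nat and cl cr :: cell
  defines "l \<equiv> rec_left M cl cr" and "r \<equiv> rec_right M cl cr"
  shows "jump_w M g rho cl cr m \<bullet> flux_ES M g cl cr m
      - avg_w_phi M g rho cl cr m \<bullet> jump_r M rho cl cr m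
    = rho m * g * (((hgt r m * vel cr m + hgt l m * vel cl m) / 2)
        * ((head M rho cr m - head M rho r m) - (head M rho cl m - head M rho l m)))
      - \<bar>lambda_max M g cl cr\<bar> / 2
        * (rho m * g * ((head M rho cr m - head M rho cl m) * (hgt r m - hgt l m))
           + rho m * ((hgt r m + hgt l m) / 2) * (vel cr m - vel cl m)\<^sup>2)"
proof -
  have v: "vel l = vel cl" "vel r = vel cr"
    by (simp_all add: l_def r_def rec_left_def rec_right_def vel_reconstruct)
  show ?thesis
    unfolding flux_ES_def flux_EC_def jump_w_def avg_w_phi_def jump_r_def
      l_def[symmetric] r_def[symmetric]
    by (simp add: jump_def avg_def hadamard_def phi_def rvec_def cons_vars_def
          entropy_vars_def Let_def v)
      (simp add: field_simps power2_eq_square)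
qed

text \<open>
  Here \<open>p\<close> and \<open>q\<close> are the reconstructed thicknesses of a layer on the left and on the right,
  \<open>u\<close> and \<open>v\<close> its velocities, and \<open>D\<close> and \<open>E\<close> its unreconstructed minus its reconstructed heads; only the cross terms \<open>p E\<close> and \<open>q D\<close> survive.
\<close>

lemma flux_correction_le:
  fixes p q D E u v a :: real
  assumes "p \<ge> 0" "q \<ge> 0" "D \<le> 0" "E \<le> 0" "p * D = 0" "q * E = 0" "\<bar>u\<bar> \<le> a" "\<bar>v\<bar> \<le> a"
  shows "(q * v + p * u) / 2 * (E - D) \<le> a / 2 * ((E - D) * (q - p))"
proof -
  have "0 \<le> (p * - E) * (a + u)" "0 \<le> (q * - D) * (a - v)"
    using assms by (intro mult_nonneg_nonneg; simp)+
  moreover have "a / 2 * ((E - D) * (q - p)) - (q * v + p * u) / 2 * (E - D)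
      = ((p * - E) * (a + u) + (q * - D) * (a - v)) / 2
        + (q * E) * (a - v) / 2 + (p * D) * (a + u) / 2"
    by (simp add: field_simps)
  ultimately show ?thesis using assms(5,6) by simp
qed

lemma layer_entropy_production_le:
  fixes cl cr :: cell
  assumes "admissible M cl" "admissible M cr" "m \<in> {1..M}" "g > 0"
    and rho: "rho 1 > 0" "strict_mono_on {1..M} rho"
  defines "l \<equiv> rec_left M cl cr" and "r \<equiv> rec_right M cl cr"
  shows "jump_w M g rho cl cr m \<bullet> flux_ES M g cl cr m
      - avg_w_phi M g rho cl cr m \<bullet> jump_r M rho cl cr m
    \<le> - (\<bar>lambda_max M g cl cr\<bar> / 2 * g)
        * (rho m * (head M rho r m - head M rho l m) * (hgt r m - hgt l m))"
proof -
  define a where "a = \<bar>lambda_max M g cl cr\<bar>"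
  define D where "D = head M rho cl m - head M rho l m"
  define E where "E = head M rho cr m - head M rho r m"
  have B: "bot cl \<le> max (bot cl) (bot cr)" "bot cr \<le> max (bot cl) (bot cr)"
    by simp_all
  have hgt: "hgt l m \<ge> 0" "hgt r m \<ge> 0"
    using admissible_reconstruct[OF assms(1) B(1)] admissible_reconstruct[OF assms(2) B(2)]
      assms(3) by (auto simp: l_def r_def rec_left_def rec_right_def admissible_def)
  have rho_m: "rho m > 0"
    using density_pos[OF rho assms(3)] .
  have "(hgt r m * vel cr m + hgt l m * vel cl m) / 2 * (E - D)
      \<le> a / 2 * ((E - D) * (hgt r m - hgt l m))"
  proof (rule flux_correction_le[OF hgt])
    show "D \<le> 0" "hgt l m * D = 0"
      using head_le_head_reconstruct[OF assms(1) B(1) assms(3) rho]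
        hgt_reconstruct_mult_head_diff[OF assms(1) B(1) assms(3) rho]
      by (simp_all add: D_def l_def rec_left_def)
    show "E \<le> 0" "hgt r m * E = 0"
      using head_le_head_reconstruct[OF assms(2) B(2) assms(3) rho]
        hgt_reconstruct_mult_head_diff[OF assms(2) B(2) assms(3) rho]
      by (simp_all add: E_def r_def rec_right_def)
    show "\<bar>vel cl m\<bar> \<le> a" "\<bar>vel cr m\<bar> \<le> a"
      using abs_vel_le_lambda_max[OF assms(3,4,1), of cr] by (simp_all add: a_def)
  qed
  then have "rho m * g * ((hgt r m * vel cr m + hgt l m * vel cl m) / 2 * (E - D))
      \<le> rho m * g * (a / 2 * ((E - D) * (hgt r m - hgt l m)))"
    using rho_m assms(4) by (intro mult_left_mono) auto
  moreover have "0 \<le> a / 2 * (rho m * ((hgt r m + hgt l m) / 2) * (vel cr m - vel cl m)\<^sup>2)"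
    using rho_m hgt by (simp add: a_def)
  moreover have "rho m * g * (a / 2 * ((E - D) * (hgt r m - hgt l m)))
      - a / 2 * (rho m * g * ((head M rho cr m - head M rho cl m) * (hgt r m - hgt l m)))
      = - (a / 2 * g) * (rho m * (head M rho r m - head M rho l m) * (hgt r m - hgt l m))"
    by (simp add: D_def E_def algebra_simps)
  ultimately show ?thesis
    unfolding layer_entropy_production_eq l_def[symmetric] r_def[symmetric]
      a_def[symmetric] D_def[symmetric] E_def[symmetric] distrib_left
    by linarith
qed

lemma interface_entropy_production_nonpos:
  assumes "admissible M cl" "admissible M cr" "g > 0"
    and rho: "rho 1 > 0" "strict_mono_on {1..M} rho"
  shows "sdot M (jump_w M g rho cl cr) (flux_ES M g cl cr)
    - sdot M (avg_w_phi M g rho cl cr) (jump_r M rho cl cr) \<le> 0"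
proof -
  let ?l = "rec_left M cl cr" and ?r = "rec_right M cl cr"
  have "sdot M (jump_w M g rho cl cr) (flux_ES M g cl cr)
      - sdot M (avg_w_phi M g rho cl cr) (jump_r M rho cl cr)
    \<le> (\<Sum>m=1..M. - (\<bar>lambda_max M g cl cr\<bar> / 2 * g)
        * (rho m * (head M rho ?r m - head M rho ?l m) * (hgt ?r m - hgt ?l m)))"
    unfolding sdot_def sum_subtractf[symmetric]
    using assms by (intro sum_mono layer_entropy_production_le)
  also have "\<dots> = - (\<bar>lambda_max M g cl cr\<bar> / 2 * g)
      * (\<Sum>m=1..M. rho m * (head M rho ?r m - head M rho ?l m) * (hgt ?r m - hgt ?l m))"
    by (rule sum_distrib_left[symmetric])
  also have "\<dots> \<le> 0"
    using sum_jump_head_mult_jump_hgt_nonneg[OF assms(1) _ assms(2) _ rho,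
        of "max (bot cl) (bot cr)"] assms(3)
    unfolding rec_left_def rec_right_def
    by (intro mult_nonpos_nonneg) auto
  finally show ?thesis .
qed

theorem lemma8:
  fixes M :: nat and g :: real and rho :: "nat \<Rightarrow> real"
  assumes "M \<ge> 1" and "g > 0"
    and "rho 1 > 0" and "strict_mono_on {1..M} rho"
  shows "entropy_stable M g rho (flux_ES M g) \<and>
    (\<forall>cl cr. admissible M cl \<longrightarrow> admissible M cr \<longrightarrow>
       sdot M (jump_w M g rho cl cr) (flux_ES M g cl cr)
       - sdot M (avg_w_phi M g rho cl cr) (jump_r M rho cl cr) \<le> 0)"
proof -
  have "sdot M (jump_w M g rho cl cr) (flux_ES M g cl cr)
      - sdot M (avg_w_phi M g rho cl cr) (jump_r M rho cl cr) \<le> 0"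
    if "admissible M cl" "admissible M cr" for cl cr
    using interface_entropy_production_nonpos[OF that assms(2-4)] .
  then show ?thesis
    unfolding entropy_stable_def interface_entropy_rate_eq by fastforce
qed

end
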